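(* Let $n\ge 4$ and let $p_1,p_2,\ldots,p_{n-2}$ be a rearrangement of $3,4,\ldots,n$. Then the three positional marked patterns $P_1=1\underline{2}p_1\cdots p_{n-2}$, $P_2=\underline{2}1p_1\cdots p_{n-2}$ and $P_3=2\underline{1}p_1\cdots p_{n-2}$ are pairwise $pmp$-Wilf equivalent.
   Context: A positional marked pattern of length $k$ is a permutation $\tau=\tau_1\cdots\tau_k$ of $[k]$ with exactly one entry underlined; $\pi(\tau)$ is the permutation obtained by removing the underline and $u(\tau)$ is the position of the underlined entry. For a word $w$ with distinct letters, $red(w)$ replaces the $i$-th smallest letter by $i$. For $\sigma\in S_N$, $\sigma$ has a $\tau$-match at position $\ell$ if there are indices $i_1<\cdots<i_k$ with $i_{u(\tau)}=\ell$ and $red(\sigma_{i_1}\cdots\sigma_{i_k})=\pi(\tau)$; $pmp_\tau(\sigma)$ is the number of such positions $\ell$. Two positional marked patterns $\tau,\tau'$ are $pmp$-Wilf equivalent if $\sum_{\sigma\in S_N}x^{pmp_\tau(\sigma)}=\sum_{\sigma\in S_N}x^{pmp_{\tau'}(\sigma)}$ for all $N\ge1$. In $P_1$ the underlined entry is the $2$ in position 2; in $P_2$ it is the $2$ in position 1; in $P_3$ it is the $1$ in position 2. *)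

theory Defs
  imports "HOL-Combinatorics.Multiset_Permutations" "HOL-Computational_Algebra.Polynomial"
begin

text \<open>
  Permutations of \<open>[N]\<close> are written in one-line notation, as the elements of
  \<open>permutations_of_set {1..N}\<close>: entries range over \<open>{1..N}\<close>, whereas positions are list
  indices and hence count from 0.
\<close>

definition red :: "nat list \<Rightarrow> nat list" where
  "red w = map (\<lambda>x. card {y \<in> set w. y \<le> x}) w"

text \<open>The second component is the (0-based) position of the underlined entry.\<close>

type_synonym marked_pattern = "nat list \<times> nat"

definition underlying :: "marked_pattern \<Rightarrow> nat list" where
  "underlying \<tau> = fst \<tau>"

definition upos :: "marked_pattern \<Rightarrow> nat" where
  "upos \<tau> = snd \<tau>"

definition positional_marked_pattern :: "marked_pattern \<Rightarrow> bool" where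
  "positional_marked_pattern \<tau> \<longleftrightarrow>
     underlying \<tau> \<in> permutations_of_set {1..length (underlying \<tau>)} \<and>
     upos \<tau> < length (underlying \<tau>)"

definition has_match_at :: "marked_pattern \<Rightarrow> nat list \<Rightarrow> nat \<Rightarrow> bool" where
  "has_match_at \<tau> \<sigma> l \<longleftrightarrow>
     (\<exists>is. length is = length (underlying \<tau>) \<and> sorted_wrt (<) is \<and>
           set is \<subseteq> {..<length \<sigma>} \<and> is ! upos \<tau> = l \<and>
           red (map (\<lambda>i. \<sigma> ! i) is) = underlying \<tau>)"

definition pmp :: "marked_pattern \<Rightarrow> nat list \<Rightarrow> nat" where
  "pmp \<tau> \<sigma> = card {l. l < length \<sigma> \<and> has_match_at \<tau> \<sigma> l}"

definition pmp_gen_poly :: "marked_pattern \<Rightarrow> nat \<Rightarrow> int poly" where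
  "pmp_gen_poly \<tau> N = (\<Sum>\<sigma>\<in>permutations_of_set {1..N}. monom 1 (pmp \<tau> \<sigma>))"

definition pmp_Wilf_equivalent :: "marked_pattern \<Rightarrow> marked_pattern \<Rightarrow> bool" where
  "pmp_Wilf_equivalent \<tau> \<tau>' \<longleftrightarrow>
     positional_marked_pattern \<tau> \<and> positional_marked_pattern \<tau>' \<and>
     (\<forall>N\<ge>1. pmp_gen_poly \<tau> N = pmp_gen_poly \<tau>' N)"

end

theory Submission
  imports Defs
begin

text \<open>
  Call a cell dominated if some occurrence of \<open>p\<close> lies strictly to its north-east. A point is
  marked by \<open>P\<^sub>1\<close> iff it is dominated and has a point to its south-west, and by \<open>P\<^sub>3\<close> iff it is
  the lower right end of a descent whose bounding cell (its column, the higher row) is dominated.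
  Fix a column \<open>k\<close> marked by \<open>P\<^sub>3\<close> and exchange its entry with the next larger
  one among the columns to its left. All cells touched are dominated, before and after, by the same
  occurrence of \<open>p\<close>, so the dominated region does not change; and since no entry to the left lies
  between the two exchanged ones, the marks of all other columns are unchanged. This maps the
  permutations with \<open>k\<close> marked by \<open>P\<^sub>3\<close> bijectively onto those with \<open>k\<close> marked by \<open>P\<^sub>1\<close>, so the
  two statistics can be traded against each other one column at a time. The argument uses nothing
  about \<open>p\<close>, and hence applies to the inverse permutation and the transposed pattern,
  which turns \<open>P\<^sub>3\<close> into \<open>P\<^sub>2\<close>.
\<close>


section \<open>Exchanging two statistics one index at a time\<close>

text \<open>A hybrid argument: the indices are switched from \<open>P\<close> to \<open>P'\<close>
  one by one. \<open>T k\<close> turns a \<open>P'\<close>-mark at \<open>k\<close> into a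
  \<open>P\<close>-mark at \<open>k\<close> and keeps all marks of both kinds elsewhere.\<close>

lemma sum_monom_card_eq_by_local_bijections:
  fixes P P' :: "'a \<Rightarrow> nat \<Rightarrow> bool"
  assumes fin: "finite A"
    and bij: "\<And>k. k < N \<Longrightarrow> bij_betw (T k) {a \<in> A. P' a k} {a \<in> A. P a k}"
    and P: "\<And>a k w. a \<in> A \<Longrightarrow> k < N \<Longrightarrow> w < N \<Longrightarrow> P' a k \<Longrightarrow> w \<noteq> k \<Longrightarrow> P (T k a) w = P a w"
    and P': "\<And>a k w. a \<in> A \<Longrightarrow> k < N \<Longrightarrow> w < N \<Longrightarrow> P' a k \<Longrightarrow> w \<noteq> k \<Longrightarrow> P' (T k a) w = P' a w"
  shows "(\<Sum>a\<in>A. monom (1::int) (card {k. k < N \<and> P a k})) =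
         (\<Sum>a\<in>A. monom (1::int) (card {k. k < N \<and> P' a k}))"
proof -
  define X :: "int poly" where "X = monom 1 1"
  define c where "c b = (if b then X else 1)" for b
  \<comment> \<open>The hybrid weight: indices below \<open>j\<close> are already counted by
    \<open>P'\<close>, the others still by \<open>P\<close>, so \<open>W 0\<close> and
    \<open>W N\<close> give the two sides.\<close>
  define W where "W j a = (\<Prod>k<j. c (P' a k)) * (\<Prod>k\<in>{j..<N}. c (P a k))" for j a
  have prod_c: "(\<Prod>k<N. c (B k)) = monom 1 (card {k. k < N \<and> B k})" for B
  proof -
    have "(\<Prod>k<N. c (B k)) = (\<Prod>k\<in>{k. k < N \<and> B k}. X)"
      by (rule prod.mono_neutral_cong_right) (auto simp: c_def)
    also have "\<dots> = X ^ card {k. k < N \<and> B k}" by simp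
    finally show ?thesis by (simp add: X_def monom_power)
  qed
  have step: "(\<Sum>a\<in>A. W j a) = (\<Sum>a\<in>A. W (Suc j) a)" if j: "j < N" for j
  proof -
    define G where "G a = (\<Prod>k<j. c (P' a k)) * (\<Prod>k\<in>{Suc j..<N}. c (P a k))" for a
    \<comment> \<open>Writing \<open>X\<close> as \<open>1 + (X - 1)\<close> splits off
      \<open>G\<close>, which does not involve index \<open>j\<close>. The sums of
      \<open>W j\<close> and \<open>W (Suc j)\<close> then differ only in the terms marked at
      \<open>j\<close>, and \<open>T j\<close> matches these.\<close>
    have W1: "W j a = G a + (if P a j then (X - 1) * G a else 0)" for a
    proof -
      have "{j..<N} = insert j {Suc j..<N}" using j by auto
      then show ?thesis by (auto simp: W_def G_def c_def algebra_simps)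
    qed
    have W2: "W (Suc j) a = G a + (if P' a j then (X - 1) * G a else 0)" for a
      by (auto simp: W_def G_def c_def algebra_simps)
    have "(\<Sum>a\<in>{a\<in>A. P' a j}. G a) = (\<Sum>a\<in>{a\<in>A. P' a j}. G (T j a))"
    proof (rule sum.cong)
      fix a assume "a \<in> {a\<in>A. P' a j}"
      then show "G a = G (T j a)"
        unfolding G_def using P[of a j] P'[of a j] j
        by (intro arg_cong2[of _ _ _ _ "(*)"] prod.cong) auto
    qed simp
    also have "\<dots> = (\<Sum>a\<in>{a\<in>A. P a j}. G a)"
      by (rule sum.reindex_bij_betw[OF bij[OF j]])
    finally have "(\<Sum>a\<in>A. if P a j then (X - 1) * G a else 0) =
        (\<Sum>a\<in>A. if P' a j then (X - 1) * G a else 0)"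
      using fin by (simp add: sum.inter_filter[symmetric] sum_distrib_left[symmetric])
    then show ?thesis by (simp add: W1 W2 sum.distrib)
  qed
  have "j \<le> N \<Longrightarrow> (\<Sum>a\<in>A. W 0 a) = (\<Sum>a\<in>A. W j a)" for j
    by (induction j) (use step in auto)
  from this[of N] have "(\<Sum>a\<in>A. W 0 a) = (\<Sum>a\<in>A. W N a)" by simp
  then show ?thesis
    by (simp add: W_def prod_c atLeast0LessThan)
qed

section \<open>The dominated region and its stability\<close>

text \<open>\<open>Q\<close> says which point sets count as occurrences; keeping it abstract lets
  the same argument serve the transposed pattern.\<close>

definition dominated :: "((nat \<times> nat) set \<Rightarrow> bool) \<Rightarrow> (nat \<times> nat) set \<Rightarrow> nat \<Rightarrow> nat \<Rightarrow> bool" where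
  "dominated Q S x y \<longleftrightarrow> (\<exists>T\<subseteq>S. Q T \<and> (\<forall>(a, b)\<in>T. x < a \<and> y < b))"

lemma dominated_antimono:
  "dominated Q S x y \<Longrightarrow> x' \<le> x \<Longrightarrow> y' \<le> y \<Longrightarrow> dominated Q S x' y'"
  unfolding dominated_def by fastforce

text \<open>A witness \<open>T0\<close> for the corner \<open>(k, m)\<close> lies outside the
  rectangle and survives the change. A witness for \<open>(x, y)\<close> either avoids the rectangle
  and survives too, or meets it; then \<open>(x, y)\<close> is weakly south-west of the corner and
  \<open>T0\<close> takes over.\<close>

lemma dominated_cong_outside_aux:
  assumes "S - {..k} \<times> {..m} = S' - {..k} \<times> {..m}" and "dominated Q S k m"
  shows "dominated Q S' k m" and "dominated Q S x y \<Longrightarrow> dominated Q S' x y"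
proof -
  obtain T0 where T0: "T0 \<subseteq> S" "Q T0" "\<forall>(a, b)\<in>T0. k < a \<and> m < b"
    using assms(2) unfolding dominated_def by blast
  have sub: "T \<subseteq> S'" if "T \<subseteq> S" "T \<inter> {..k} \<times> {..m} = {}" for T
    using that assms(1) by blast
  have T0': "T0 \<subseteq> S'" by (rule sub) (use T0 in fastforce)+
  then show *: "dominated Q S' k m" using T0(2,3) unfolding dominated_def by (intro exI[of _ T0]) simp
  assume "dominated Q S x y"
  then obtain T where T: "T \<subseteq> S" "Q T" "\<forall>(a, b)\<in>T. x < a \<and> y < b"
    unfolding dominated_def by blast
  show "dominated Q S' x y"
  proof (cases "T \<inter> {..k} \<times> {..m} = {}")
    case True
    then have "T \<subseteq> S'" using T(1) sub by simp
    then show ?thesis using T(2,3) unfolding dominated_def by (intro exI[of _ T]) simp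
  next
    case False
    then obtain a b where "(a, b) \<in> T" "a \<le> k" "b \<le> m" by auto
    then have "x \<le> k" "y \<le> m" using T(3) by fastforce+
    then show ?thesis using dominated_antimono[OF *] by blast
  qed
qed

lemma dominated_cong_outside:
  assumes "S - {..k} \<times> {..m} = S' - {..k} \<times> {..m}" and "dominated Q S k m"
  shows "dominated Q S' = dominated Q S"
proof (intro ext iffI)
  fix x y
  show "dominated Q S' x y" if "dominated Q S x y"
    using dominated_cong_outside_aux(2)[OF assms that] .
  show "dominated Q S x y" if "dominated Q S' x y"
    \<comment> \<open>The corner is dominated in \<open>S'\<close> as well, so the roles of
      \<open>S\<close> and \<open>S'\<close> may be exchanged.\<close>
    using dominated_cong_outside_aux(2)[OF assms(1)[symmetric] dominated_cong_outside_aux(1)[OF assms] that] .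
qed

section \<open>Marked columns and the effect of one exchange\<close>

definition points :: "nat \<Rightarrow> (nat \<Rightarrow> nat) \<Rightarrow> (nat \<times> nat) set" where
  "points N f = (\<lambda>i. (i, f i)) ` {..<N}"

text \<open>
  With \<open>D\<close> the dominated region, the next two predicates say that column \<open>k\<close> is marked by \<open>P\<^sub>1\<close>
  and by \<open>P\<^sub>3\<close>, respectively.
\<close>

definition asc_end :: "(nat \<Rightarrow> nat \<Rightarrow> bool) \<Rightarrow> (nat \<Rightarrow> nat) \<Rightarrow> nat \<Rightarrow> bool" where
  "asc_end D f k \<longleftrightarrow> D k (f k) \<and> (\<exists>d<k. f d < f k)"

definition desc_end :: "(nat \<Rightarrow> nat \<Rightarrow> bool) \<Rightarrow> (nat \<Rightarrow> nat) \<Rightarrow> nat \<Rightarrow> bool" where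
  "desc_end D f k \<longleftrightarrow> (\<exists>d<k. f k < f d \<and> D k (f d))"

definition next_above :: "(nat \<Rightarrow> nat) \<Rightarrow> nat \<Rightarrow> nat \<Rightarrow> bool" where
  "next_above f k u \<longleftrightarrow> u < k \<and> f k < f u \<and> (\<forall>d<k. \<not> (f k < f d \<and> f d < f u))"

definition next_below :: "(nat \<Rightarrow> nat) \<Rightarrow> nat \<Rightarrow> nat \<Rightarrow> bool" where
  "next_below f k u \<longleftrightarrow> u < k \<and> f u < f k \<and> (\<forall>d<k. \<not> (f u < f d \<and> f d < f k))"

text \<open>The bound \<open>f u \<le> f d\<close> serves to pass dominance from the cell in row
  \<open>f d\<close> down to the one in row \<open>f u\<close>.\<close>

lemma ex_next_above:
  assumes "d < k" "f k < f d"
  shows "\<exists>u. next_above f k u \<and> f u \<le> f d"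
proof -
  obtain u where u: "u < k \<and> f k < f u" and min: "\<And>y. y < k \<and> f k < f y \<Longrightarrow> f u \<le> f y"
    using ex_has_least_nat[of "\<lambda>u. u < k \<and> f k < f u" d f] assms by blast
  have "next_above f k u" unfolding next_above_def using u min by (meson not_le)
  then show ?thesis using min assms by blast
qed

lemma ex_next_below:
  assumes "d < k" "f d < f k"
  shows "\<exists>u. next_below f k u"
proof -
  obtain u where u: "u < k \<and> f u < f k" and max: "\<And>y. y < k \<and> f y < f k \<Longrightarrow> f y \<le> f u"
    \<comment> \<open>The last argument \<open>f k\<close> is the upper bound that guarantees a
      maximum.\<close>
    using ex_has_greatest_nat[of "\<lambda>u. u < k \<and> f u < f k" d f "f k"] assms
    by (metis less_imp_le)
  have "next_below f k u" unfolding next_below_def using u max by (meson not_le)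
  then show ?thesis by blast
qed

lemma next_above_unique: "inj f \<Longrightarrow> next_above f k u \<Longrightarrow> next_above f k v \<Longrightarrow> u = v"
  unfolding next_above_def by (metis injD linorder_less_linear)

lemma next_below_unique: "inj f \<Longrightarrow> next_below f k u \<Longrightarrow> next_below f k v \<Longrightarrow> u = v"
  unfolding next_below_def by (metis injD linorder_less_linear)

text \<open>The gap between the two values stays empty to the left of \<open>k\<close>, so the
  reverse exchange finds the same column \<open>u\<close>. This makes the two exchanges mutually
  inverse.\<close>

lemma swap_next_above:
  assumes "next_above f k u"
  shows "next_below (f \<circ> transpose k u) k u"
  using assms unfolding next_above_def next_below_def
  by (auto simp: transpose_def)

lemma swap_next_below:
  assumes "next_below f k u"
  shows "next_above (f \<circ> transpose k u) k u"
  using assms unfolding next_above_def next_below_def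
  by (auto simp: transpose_def)

text \<open>The two removed and the two new points all have columns at most \<open>k\<close> and
  rows at most \<open>m\<close>.\<close>

lemma points_swap_outside:
  assumes "u < k" "k < N" "f k \<le> m" "f u \<le> m"
  shows "points N f - {..k} \<times> {..m} = points N (f \<circ> transpose k u) - {..k} \<times> {..m}"
  using assms unfolding points_def by (auto simp: transpose_def image_iff)

lemma ex_less_transpose:
  fixes k u w :: nat
  assumes "k < w" "u < w"
  shows "(\<exists>d<w. P (transpose k u d)) \<longleftrightarrow> (\<exists>d<w. P d)"
proof -
  have "transpose k u d < w" if "d < w" for d using that assms by (simp add: transpose_def)
  then show ?thesis by (metis transpose_involutory)
qed

text \<open>Cases by the position of \<open>w\<close>. Left of \<open>u\<close> nothing changes. At
  \<open>u\<close> the old and new cells both lie in \<open>D\<close>, and no entry to the left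
  falls between the two values. Between \<open>u\<close> and \<open>k\<close>, the entry
  \<open>f w\<close> compares equally with both values. Right of \<open>k\<close> the set of earlier
  entries is the same.\<close>

lemma asc_end_swap:
  assumes inj: "inj f" and D: "\<And>x y x' y'. D x y \<Longrightarrow> x' \<le> x \<Longrightarrow> y' \<le> y \<Longrightarrow> D x' y'"
    and u: "next_above f k u" and Dk: "D k (f u)" and w: "w \<noteq> k"
  shows "asc_end D (f \<circ> transpose k u) w = asc_end D f w"
proof -
  let ?g = "f \<circ> transpose k u"
  have uk: "u < k" "f k < f u" and gap: "\<And>d. d < k \<Longrightarrow> f d < f u \<Longrightarrow> f d < f k"
    using u inj unfolding next_above_def by (auto simp: inj_eq) (metis inj injD linorder_neqE_nat less_irrefl)
  have g: "?g k = f u" "?g u = f k" "\<And>d. d \<noteq> k \<Longrightarrow> d \<noteq> u \<Longrightarrow> ?g d = f d"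
    by (auto simp: transpose_def)
  consider "w < u" | "w = u" | "u < w" "w < k" | "k < w" using w by linarith
  then show ?thesis
  proof cases
    case 1
    then show ?thesis using uk g by (auto simp: asc_end_def)
  next
    case 2
    have "D u (f u)" "D u (f k)" using D[OF Dk] uk by auto
    moreover have "(\<exists>d<u. f d < f k) \<longleftrightarrow> (\<exists>d<u. f d < f u)"
      using gap uk by (metis order.strict_trans)
    ultimately show ?thesis using uk g 2 by (auto simp: asc_end_def)
  next
    case 3
    have "f w \<noteq> f k" using inj 3 by (auto simp: inj_eq)
    then have "f k < f w \<longleftrightarrow> f u < f w" using gap[of w] 3 uk inj by (metis inj_eq less_asym' linorder_neqE_nat order.strict_trans)
    then have "(\<exists>d<w. ?g d < f w) \<longleftrightarrow> (\<exists>d<w. f d < f w)"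
      using 3 g uk by metis
    then show ?thesis using 3 g uk by (auto simp: asc_end_def)
  next
    case 4
    then have "(\<exists>d<w. ?g d < f w) \<longleftrightarrow> (\<exists>d<w. f d < f w)"
      using ex_less_transpose[of k w u "\<lambda>d. f d < f w"] uk by simp
    then show ?thesis using 4 g uk by (auto simp: asc_end_def)
  qed
qed

text \<open>The same cases. For \<open>w\<close> strictly between \<open>u\<close> and
  \<open>k\<close> the candidate in column \<open>u\<close> changes its value, but both bounding
  cells \<open>(w, f u)\<close> and \<open>(w, f k)\<close> lie in \<open>D\<close>, so it serves
  before the exchange iff it serves after.\<close>

lemma desc_end_swap:
  assumes inj: "inj f" and D: "\<And>x y x' y'. D x y \<Longrightarrow> x' \<le> x \<Longrightarrow> y' \<le> y \<Longrightarrow> D x' y'"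
    and u: "next_above f k u" and Dk: "D k (f u)" and w: "w \<noteq> k"
  shows "desc_end D (f \<circ> transpose k u) w = desc_end D f w"
proof -
  let ?g = "f \<circ> transpose k u"
  have uk: "u < k" "f k < f u" and gap: "\<And>d. d < k \<Longrightarrow> f d < f u \<Longrightarrow> f d < f k"
    using u inj unfolding next_above_def by (auto simp: inj_eq) (metis inj injD linorder_neqE_nat less_irrefl)
  have g: "?g k = f u" "?g u = f k" "\<And>d. d \<noteq> k \<Longrightarrow> d \<noteq> u \<Longrightarrow> ?g d = f d"
    by (auto simp: transpose_def)
  consider "w < u" | "w = u" | "u < w" "w < k" | "k < w" using w by linarith
  then show ?thesis
  proof cases
    case 1
    then show ?thesis using uk g by (auto simp: desc_end_def)
  next
    case 2
    have "f k < f d \<longleftrightarrow> f u < f d" if "d < u" for d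
      using gap[of d] uk that inj by (metis inj_eq less_asym' linorder_neqE_nat order.strict_trans)
    then show ?thesis using uk g 2 by (auto simp: desc_end_def)
  next
    case 3
    have "f w \<noteq> f k" using inj 3 by (auto simp: inj_eq)
    then have *: "f w < f k \<longleftrightarrow> f w < f u" using gap[of w] 3 uk by auto
    have "D w (f u)" "D w (f k)" using D[OF Dk] uk 3 by auto
    then have "(\<exists>d<w. f w < ?g d \<and> D w (?g d)) \<longleftrightarrow> (\<exists>d<w. f w < f d \<and> D w (f d))"
      using 3 g uk * by metis
    then show ?thesis using 3 g uk by (auto simp: desc_end_def)
  next
    case 4
    then have "(\<exists>d<w. f w < ?g d \<and> D w (?g d)) \<longleftrightarrow> (\<exists>d<w. f w < f d \<and> D w (f d))"
      using ex_less_transpose[of k w u "\<lambda>d. f w < f d \<and> D w (f d)"] uk by simp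
    then show ?thesis using 4 g uk by (auto simp: desc_end_def)
  qed
qed

section \<open>Equidistribution of the two kinds of marks\<close>

abbreviation pasc :: "((nat \<times> nat) set \<Rightarrow> bool) \<Rightarrow> nat \<Rightarrow> (nat \<Rightarrow> nat) \<Rightarrow> nat \<Rightarrow> bool" where
  "pasc Q N f \<equiv> asc_end (dominated Q (points N f)) f"

abbreviation pdesc :: "((nat \<times> nat) set \<Rightarrow> bool) \<Rightarrow> nat \<Rightarrow> (nat \<Rightarrow> nat) \<Rightarrow> nat \<Rightarrow> bool" where
  "pdesc Q N f \<equiv> desc_end (dominated Q (points N f)) f"

lemma pdesc_next_above:
  assumes "pdesc Q N f k"
  obtains u where "next_above f k u" "dominated Q (points N f) k (f u)"
proof -
  obtain d where d: "d < k" "f k < f d" "dominated Q (points N f) k (f d)"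
    using assms unfolding desc_end_def by blast
  obtain u where u: "next_above f k u" "f u \<le> f d" using ex_next_above[OF d(1,2)] by blast
  show thesis using that[OF u(1) dominated_antimono[OF d(3) order_refl u(2)]] .
qed

lemma pasc_pdesc_equidistributed:
  "(\<Sum>f | f permutes {..<N}. monom (1::int) (card {k. k < N \<and> pasc Q N f k})) =
   (\<Sum>f | f permutes {..<N}. monom (1::int) (card {k. k < N \<and> pdesc Q N f k}))"
proof (rule sum_monom_card_eq_by_local_bijections)
  let ?A = "{f. f permutes {..<N}}"
  \<comment> \<open>The description operator denotes the intended column only if one exists; both
    maps are evaluated only at columns where this holds.\<close>
  define T where "T k f = f \<circ> transpose k (THE u. next_above f k u)" for k and f :: "nat \<Rightarrow> nat"
  define T' where "T' k f = f \<circ> transpose k (THE u. next_below f k u)" for k and f :: "nat \<Rightarrow> nat"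
  have T_eq: "T k f = f \<circ> transpose k u" if "inj f" "next_above f k u" for k f u
    using that next_above_unique unfolding T_def by (metis the_equality)
  have T'_eq: "T' k f = f \<circ> transpose k u" if "inj f" "next_below f k u" for k f u
    using that next_below_unique unfolding T'_def by (metis the_equality)
  have perm: "f \<circ> transpose k u permutes {..<N}" if "f permutes {..<N}" "k < N" "u < k" for f k u
    using that by (auto intro!: permutes_compose permutes_swap_id)
  \<comment> \<open>The rectangle has corner \<open>(k, f u)\<close>, the higher of the two rows;
    for \<open>down\<close> the higher row is \<open>f k\<close>.\<close>
  have up: "dominated Q (points N (f \<circ> transpose k u)) = dominated Q (points N f)"
    if "k < N" "next_above f k u" "dominated Q (points N f) k (f u)" for f k u
    using that by (intro dominated_cong_outside[OF points_swap_outside]) (auto simp: next_above_def)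
  have down: "dominated Q (points N (f \<circ> transpose k u)) = dominated Q (points N f)"
    if "k < N" "next_below f k u" "dominated Q (points N f) k (f k)" for f k u
    using that by (intro dominated_cong_outside[OF points_swap_outside]) (auto simp: next_below_def)
  show "finite ?A" by (simp add: finite_permutations)
  show "bij_betw (T k) {f \<in> ?A. pdesc Q N f k} {f \<in> ?A. pasc Q N f k}" if k: "k < N" for k
  proof (rule bij_betw_byWitness[where f' = "T' k"])
    have 1: "T k f \<in> {f \<in> ?A. pasc Q N f k} \<and> T' k (T k f) = f"
      if "f \<in> {f \<in> ?A. pdesc Q N f k}" for f
    proof -
      have f: "f permutes {..<N}" "pdesc Q N f k" and inj: "inj f"
        using that permutes_inj by auto
      obtain u where u: "next_above f k u" "dominated Q (points N f) k (f u)"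
        using pdesc_next_above[OF f(2)] .
      let ?g = "f \<circ> transpose k u"
      have uk: "u < k" using u(1) by (simp add: next_above_def)
      have g: "?g permutes {..<N}" "next_below ?g k u"
        using perm[OF f(1) k uk] swap_next_above[OF u(1)] by auto
      \<comment> \<open>Column \<open>k\<close> now carries \<open>f u\<close>, so its own cell is
        the old dominated bounding cell, and column \<open>u\<close> supplies the smaller
        entry.\<close>
      have "pasc Q N ?g k"
        using u uk g(2) unfolding asc_end_def up[OF k u] by (auto simp: next_below_def)
      moreover have "T' k ?g = f"
        using T'_eq[OF permutes_inj[OF g(1)] g(2)] by (simp add: comp_assoc)
      ultimately show ?thesis using g T_eq[OF inj u(1)] by simp
    qed
    have 2: "T' k f \<in> {f \<in> ?A. pdesc Q N f k} \<and> T k (T' k f) = f"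
      if "f \<in> {f \<in> ?A. pasc Q N f k}" for f
    proof -
      have f: "f permutes {..<N}" "pasc Q N f k" and inj: "inj f"
        using that permutes_inj by auto
      obtain u where u: "next_below f k u" "dominated Q (points N f) k (f k)"
        using f(2) ex_next_below unfolding asc_end_def by blast
      let ?g = "f \<circ> transpose k u"
      have uk: "u < k" using u(1) by (simp add: next_below_def)
      have g: "?g permutes {..<N}" "next_above ?g k u"
        using perm[OF f(1) k uk] swap_next_below[OF u(1)] by auto
      \<comment> \<open>The old entry \<open>f k\<close> now sits in column \<open>u\<close>, so the
        bounding cell is the cell \<open>(k, f k)\<close> that was dominated before.\<close>
      have "pdesc Q N ?g k"
        using u uk g(2) unfolding desc_end_def down[OF k u] by (auto simp: next_above_def)
      moreover have "T k ?g = f"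
        using T_eq[OF permutes_inj[OF g(1)] g(2)] by (simp add: comp_assoc)
      ultimately show ?thesis using g T'_eq[OF inj u(1)] by simp
    qed
    show "\<forall>a\<in>{f \<in> ?A. pdesc Q N f k}. T' k (T k a) = a" using 1 by blast
    show "\<forall>a\<in>{f \<in> ?A. pasc Q N f k}. T k (T' k a) = a" using 2 by blast
    show "T k ` {f \<in> ?A. pdesc Q N f k} \<subseteq> {f \<in> ?A. pasc Q N f k}" using 1 by blast
    show "T' k ` {f \<in> ?A. pasc Q N f k} \<subseteq> {f \<in> ?A. pdesc Q N f k}" using 2 by blast
  qed
  fix f k w
  assume A: "f \<in> ?A" "k < N" "pdesc Q N f k" "w \<noteq> k"
  have inj: "inj f" using A permutes_inj by auto
  obtain u where u: "next_above f k u" "dominated Q (points N f) k (f u)"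
    using pdesc_next_above[OF A(3)] .
  show "pasc Q N (T k f) w = pasc Q N f w"
    unfolding T_eq[OF inj u(1)] up[OF A(2) u]
    by (rule asc_end_swap[where D = "dominated Q (points N f)", OF inj dominated_antimono u A(4)])
  show "pdesc Q N (T k f) w = pdesc Q N f w"
    unfolding T_eq[OF inj u(1)] up[OF A(2) u]
    by (rule desc_end_swap[where D = "dominated Q (points N f)", OF inj dominated_antimono u A(4)])
qed


section \<open>Reflection in the diagonal\<close>

definition transposed :: "((nat \<times> nat) set \<Rightarrow> bool) \<Rightarrow> (nat \<times> nat) set \<Rightarrow> bool" where
  "transposed Q T \<longleftrightarrow> Q (prod.swap ` T)"

lemma dominated_transposed:
  "dominated (transposed Q) (prod.swap ` S) y x \<longleftrightarrow> dominated Q S x y"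
proof
  assume "dominated (transposed Q) (prod.swap ` S) y x"
  then obtain T where T: "T \<subseteq> prod.swap ` S" "Q (prod.swap ` T)" "\<forall>(a, b)\<in>T. y < a \<and> x < b"
    unfolding dominated_def transposed_def by blast
  have "prod.swap ` T \<subseteq> S" using T(1) by auto
  then show "dominated Q S x y"
    unfolding dominated_def using T by (intro exI[of _ "prod.swap ` T"]) auto
next
  assume "dominated Q S x y"
  then obtain T where T: "T \<subseteq> S" "Q T" "\<forall>(a, b)\<in>T. x < a \<and> y < b"
    unfolding dominated_def by blast
  then show "dominated (transposed Q) (prod.swap ` S) y x"
    unfolding dominated_def transposed_def
    by (intro exI[of _ "prod.swap ` T"]) (auto simp: image_image)
qed

lemma points_inv:
  assumes "f permutes {..<N}"
  shows "points N (inv f) = prod.swap ` points N f"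
proof -
  have "points N (inv f) = (\<lambda>i. (i, inv f i)) ` f ` {..<N}"
    unfolding points_def by (simp add: permutes_image[OF assms])
  then show ?thesis
    by (simp add: points_def image_image permutes_inverses[OF assms])
qed

lemma ex_permutes:
  assumes "f permutes S"
  shows "(\<exists>d. P d) \<longleftrightarrow> (\<exists>i. P (f i))"
  using permutes_surj[OF assms] by (metis surjD)

text \<open>Reflection preserves both south-west and north-east, and takes the point of column
  \<open>l\<close> to that of column \<open>f l\<close>.\<close>

lemma pasc_inv:
  assumes "f permutes {..<N}"
  shows "pasc (transposed Q) N (inv f) (f l) \<longleftrightarrow> pasc Q N f l"
  unfolding asc_end_def points_inv[OF assms] dominated_transposed
  by (subst ex_permutes[OF assms]) (auto simp: permutes_inverses[OF assms])

text \<open>Reflection exchanges the two ends of a descent and carries bounding cell to bounding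
  cell, so the right-hand side marks upper left ends, as \<open>P\<^sub>2\<close> does.\<close>

lemma pdesc_inv:
  assumes "f permutes {..<N}"
  shows "pdesc (transposed Q) N (inv f) (f l) \<longleftrightarrow>
         (\<exists>i>l. f i < f l \<and> dominated Q (points N f) i (f l))"
  unfolding desc_end_def points_inv[OF assms] dominated_transposed
  by (subst ex_permutes[OF assms]) (auto simp: permutes_inverses[OF assms])

lemma card_permutes:
  assumes "f permutes {..<N}"
  shows "card {l. l < N \<and> P (f l)} = card {m. m < N \<and> P m}"
proof (rule bij_betw_same_card)
  have "f l < N \<longleftrightarrow> l < N" for l using permutes_in_image[OF assms, of l] by simp
  moreover have "\<exists>l. m = f l" for m using permutes_surj[OF assms] by (metis surjD)
  ultimately show "bij_betw f {l. l < N \<and> P (f l)} {m. m < N \<and> P m}"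
    using permutes_inj_on[OF assms] by (auto simp: bij_betw_def image_iff) (metis)
qed

text \<open>Reflect, apply the equidistribution to the transposed predicate, and reflect back:
  ascent marks return to themselves, while descent marks move to the other end.\<close>

corollary pasc_transposed_equidistributed:
  "(\<Sum>f | f permutes {..<N}. monom (1::int) (card {l. l < N \<and> pasc Q N f l})) =
   (\<Sum>f | f permutes {..<N}. monom (1::int)
      (card {l. l < N \<and> (\<exists>i>l. f i < f l \<and> dominated Q (points N f) i (f l))}))"
  (is "?L = ?R")
proof -
  let ?A = "{f. f permutes {..<N}}" and ?Q = "transposed Q"
  have inv: "(\<Sum>f\<in>?A. h (inv f)) = (\<Sum>f\<in>?A. h f)" for h :: "(nat \<Rightarrow> nat) \<Rightarrow> int poly"
    by (rule sum.reindex_bij_witness[where i = inv and j = inv])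
       (auto simp: permutes_inv permutes_inv_inv)
  have "?L = (\<Sum>f\<in>?A. monom 1 (card {m. m < N \<and> pasc ?Q N (inv f) m}))"
  proof (rule sum.cong)
    fix f assume "f \<in> ?A"
    then have f: "f permutes {..<N}" by simp
    show "monom (1::int) (card {l. l < N \<and> pasc Q N f l}) =
        monom 1 (card {m. m < N \<and> pasc ?Q N (inv f) m})"
      using card_permutes[OF f, of "pasc ?Q N (inv f)"] by (simp only: pasc_inv[OF f])
  qed simp
  also have "\<dots> = (\<Sum>f\<in>?A. monom 1 (card {m. m < N \<and> pasc ?Q N f m}))"
    by (rule inv)
  also have "\<dots> = (\<Sum>f\<in>?A. monom 1 (card {m. m < N \<and> pdesc ?Q N f m}))"
    by (rule pasc_pdesc_equidistributed)
  also have "\<dots> = (\<Sum>f\<in>?A. monom 1 (card {m. m < N \<and> pdesc ?Q N (inv f) m}))"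
    by (rule inv[symmetric])
  also have "\<dots> = ?R"
  proof (rule sum.cong)
    fix f assume "f \<in> ?A"
    then have f: "f permutes {..<N}" by simp
    show "monom (1::int) (card {m. m < N \<and> pdesc ?Q N (inv f) m}) =
        monom 1 (card {l. l < N \<and> (\<exists>i>l. f i < f l \<and> dominated Q (points N f) i (f l))})"
      using card_permutes[OF f, of "pdesc ?Q N (inv f)"] by (simp only: pdesc_inv[OF f])
  qed simp
  finally show ?thesis .
qed

section \<open>Reduction of words as order isomorphism\<close>

text \<open>Comparing entries pairwise avoids ranks, so letters can be peeled off the front and a
  uniform shift is harmless.\<close>

definition order_iso :: "nat list \<Rightarrow> nat list \<Rightarrow> bool" where
  "order_iso w p \<longleftrightarrow> length w = length p \<and>
     (\<forall>i<length p. \<forall>j<length p. w ! i < w ! j \<longleftrightarrow> p ! i < p ! j)"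

lemma order_iso_map_Suc: "order_iso (map Suc w) p \<longleftrightarrow> order_iso w p"
  unfolding order_iso_def by auto

lemma order_iso_Cons:
  "order_iso (x # w) (y # p) \<longleftrightarrow> order_iso w p \<and>
     (\<forall>i<length p. (x < w ! i \<longleftrightarrow> y < p ! i) \<and> (w ! i < x \<longleftrightarrow> p ! i < y))"
  unfolding order_iso_def length_Cons All_less_Suc2 by auto

lemma all_nth_const:
  assumes "length w = length p"
  shows "(\<forall>i<length p. P (w ! i)) \<longleftrightarrow> (\<forall>z\<in>set w. P z)"
  using assms by (auto simp: all_set_conv_all_nth)

text \<open>All letters of \<open>p\<close> exceed 2, so the later entries must lie above both
  leading ones, and being above the larger suffices.\<close>

lemma order_iso_12:
  assumes "\<forall>z\<in>set p. 2 < z"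
  shows "order_iso (x # y # w) (1 # 2 # p) \<longleftrightarrow> x < y \<and> (\<forall>z\<in>set w. y < z) \<and> order_iso w p"
proof (cases "length w = length p")
  case True
  have "2 < p ! i" if "i < length p" for i using assms that by simp
  then have "order_iso (x # y # w) (1 # 2 # p) \<longleftrightarrow>
      order_iso w p \<and> (\<forall>i<length p. y < w ! i) \<and> x < y \<and> (\<forall>i<length p. x < w ! i)"
    unfolding order_iso_Cons length_Cons All_less_Suc2 by fastforce
  then show ?thesis unfolding all_nth_const[OF True] by fastforce
qed (auto simp: order_iso_def)

lemma order_iso_21:
  assumes "\<forall>z\<in>set p. 2 < z"
  shows "order_iso (x # y # w) (2 # 1 # p) \<longleftrightarrow> y < x \<and> (\<forall>z\<in>set w. x < z) \<and> order_iso w p"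
proof (cases "length w = length p")
  case True
  have "2 < p ! i" if "i < length p" for i using assms that by simp
  then have "order_iso (x # y # w) (2 # 1 # p) \<longleftrightarrow>
      order_iso w p \<and> (\<forall>i<length p. y < w ! i) \<and> y < x \<and> (\<forall>i<length p. x < w ! i)"
    unfolding order_iso_Cons length_Cons All_less_Suc2 by fastforce
  then show ?thesis unfolding all_nth_const[OF True] by fastforce
qed (auto simp: order_iso_def)

lemma card_set_le_nth:
  assumes "distinct w"
  shows "card {y \<in> set w. y \<le> x} = card {j. j < length w \<and> w ! j \<le> (x::nat)}"
proof -
  have "{y \<in> set w. y \<le> x} = (\<lambda>j. w ! j) ` {j. j < length w \<and> w ! j \<le> x}"
    by (auto simp: in_set_conv_nth)
  moreover have "inj_on (\<lambda>j. w ! j) {j. j < length w \<and> w ! j \<le> x}"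
    using assms by (auto simp: inj_on_def nth_eq_iff_index_eq)
  ultimately show ?thesis by (simp add: card_image)
qed

lemma red_nth_less_iff:
  assumes "i < length w" "j < length w"
  shows "red w ! i < red w ! j \<longleftrightarrow> w ! i < w ! j"
proof -
  have less: "card {y \<in> set w. y \<le> a} < card {y \<in> set w. y \<le> b}" if "a < b" "b \<in> set w" for a b
  proof (rule psubset_card_mono)
    have "b \<in> {y \<in> set w. y \<le> b}" "b \<notin> {y \<in> set w. y \<le> a}" using that by auto
    moreover have "{y \<in> set w. y \<le> a} \<subseteq> {y \<in> set w. y \<le> b}" using that by auto
    ultimately show "{y \<in> set w. y \<le> a} \<subset> {y \<in> set w. y \<le> b}" by blast
  qed simp
  have "card {y \<in> set w. y \<le> w ! i} < card {y \<in> set w. y \<le> w ! j} \<longleftrightarrow> w ! i < w ! j"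
    using less[of "w ! i" "w ! j"] less[of "w ! j" "w ! i"] assms
    by (metis less_asym' linorder_neqE_nat nth_mem)
  then show ?thesis using assms by (simp add: red_def)
qed

text \<open>\<open>red\<close> preserves comparisons. Conversely, the rank of an entry depends only
  on comparisons, and a permutation of an initial segment is its own list of ranks.\<close>

lemma red_eq_iff_order_iso:
  assumes "distinct w" and p: "p \<in> permutations_of_set {1..length p}"
  shows "red w = p \<longleftrightarrow> order_iso w p"
proof
  assume eq: "red w = p"
  then have "length w = length p" by (auto simp: red_def)
  then show "order_iso w p"
    unfolding order_iso_def using red_nth_less_iff[of _ w] eq by simp
next
  assume iso: "order_iso w p"
  then have len: "length w = length p" by (simp add: order_iso_def)
  have set_p: "set p = {1..length p}" and dist_p: "distinct p"
    using p by (auto simp: permutations_of_set_def)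
  show "red w = p"
  proof (rule nth_equalityI)
    show "length (red w) = length p" using len by (simp add: red_def)
    fix i assume "i < length (red w)"
    then have i: "i < length p" using len by (simp add: red_def)
    have "red w ! i = card {j. j < length w \<and> w ! j \<le> w ! i}"
      using i len by (simp add: red_def card_set_le_nth[OF assms(1)])
    also have "{j. j < length w \<and> w ! j \<le> w ! i} = {j. j < length p \<and> p ! j \<le> p ! i}"
      using iso i len unfolding order_iso_def by (metis not_less)
    also have "card \<dots> = card {y \<in> set p. y \<le> p ! i}"
      using card_set_le_nth[OF dist_p] by simp
    also have "{y \<in> set p. y \<le> p ! i} = {1..p ! i}"
      using nth_mem[OF i] unfolding set_p by auto
    finally show "red w ! i = p ! i" by simp
  qed
qed

section \<open>From pattern matches to marked columns\<close>

text \<open>A set of points, as \<open>dominated\<close> expects. The entries \<open>w\<close> are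
  tied to a permutation only later, when the set is required to lie in its graph.\<close>

definition occurrence :: "nat list \<Rightarrow> (nat \<times> nat) set \<Rightarrow> bool" where
  "occurrence p T \<longleftrightarrow> (\<exists>js w. sorted_wrt (<) js \<and> length js = length w \<and> order_iso w p \<and>
     T = set (zip js w))"

lemma dominated_occurrence:
  "dominated (occurrence p) (points N f) x y \<longleftrightarrow>
     (\<exists>js. sorted_wrt (<) js \<and> set js \<subseteq> {..<N} \<and> order_iso (map f js) p \<and>
       (\<forall>j\<in>set js. x < j \<and> y < f j))"
proof
  assume "dominated (occurrence p) (points N f) x y"
  then obtain js w where js: "sorted_wrt (<) js" "length js = length w" "order_iso w p"
    and sub: "set (zip js w) \<subseteq> points N f" and dom: "\<forall>(a, b)\<in>set (zip js w). x < a \<and> y < b"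
    unfolding dominated_def occurrence_def by blast
  have nth: "js ! i < N \<and> w ! i = f (js ! i) \<and> x < js ! i \<and> y < w ! i" if "i < length js" for i
  proof -
    have "(js ! i, w ! i) \<in> set (zip js w)" using that js(2) by (auto simp: set_zip)
    then show ?thesis using sub dom by (auto simp: points_def)
  qed
  then have "w = map f js" using js(2) by (auto intro: nth_equalityI)
  moreover have "\<forall>j\<in>set js. j < N \<and> x < j \<and> y < f j"
    using nth by (metis in_set_conv_nth)
  ultimately show "\<exists>js. sorted_wrt (<) js \<and> set js \<subseteq> {..<N} \<and> order_iso (map f js) p \<and>
       (\<forall>j\<in>set js. x < j \<and> y < f j)"
    using js by (intro exI[of _ js]) auto
next
  assume "\<exists>js. sorted_wrt (<) js \<and> set js \<subseteq> {..<N} \<and> order_iso (map f js) p \<and>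
       (\<forall>j\<in>set js. x < j \<and> y < f j)"
  then obtain js where js: "sorted_wrt (<) js" "set js \<subseteq> {..<N}" "order_iso (map f js) p"
    "\<forall>j\<in>set js. x < j \<and> y < f j" by blast
  have zip: "set (zip js (map f js)) = (\<lambda>i. (i, f i)) ` set js"
    by (auto simp: zip_map2 zip_same_conv_map)
  have "occurrence p ((\<lambda>i. (i, f i)) ` set js)"
    unfolding occurrence_def using js zip by (metis length_map)
  then show "dominated (occurrence p) (points N f) x y"
    unfolding dominated_def points_def using js
    by (intro exI[of _ "(\<lambda>i. (i, f i)) ` set js"]) auto
qed

definition word_of :: "nat \<Rightarrow> (nat \<Rightarrow> nat) \<Rightarrow> nat list" where
  "word_of N f = map (\<lambda>i. Suc (f i)) [0..<N]"

lemma bij_betw_word_of: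
  "bij_betw (word_of N) {f. f permutes {..<N}} (permutations_of_set {1..N})"
proof -
  have inj: "inj_on (word_of N) {f. f permutes {..<N}}"
  proof (rule inj_onI)
    fix f g assume fg: "f \<in> {f. f permutes {..<N}}" "g \<in> {f. f permutes {..<N}}"
      "word_of N f = word_of N g"
    have "f i = g i" for i
    proof (cases "i < N")
      case True
      then show ?thesis using fg(3) by (auto simp: word_of_def)
    next
      case False
      then show ?thesis using fg(1,2) by (auto simp: permutes_def)
    qed
    then show "f = g" by blast
  qed
  have "word_of N f \<in> permutations_of_set {1..N}" if "f permutes {..<N}" for f
  proof -
    have "set (word_of N f) = Suc ` f ` {..<N}" by (auto simp: word_of_def)
    then have "set (word_of N f) = {1..N}"
      using permutes_image[OF that] by (simp add: image_Suc_lessThan)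
    moreover have "distinct (word_of N f)"
      using permutes_inj[OF that] by (auto simp: word_of_def distinct_map intro!: inj_onI dest: injD)
    ultimately show ?thesis by (simp add: permutations_of_set_def)
  qed
  then have "word_of N ` {f. f permutes {..<N}} \<subseteq> permutations_of_set {1..N}" by blast
  \<comment> \<open>Surjectivity comes from counting: both sets have \<open>N\<close> factorial
    elements.\<close>
  moreover have "card (word_of N ` {f. f permutes {..<N}}) = card (permutations_of_set {1..N})"
    by (simp add: card_image[OF inj] card_permutations[OF refl])
  ultimately have "word_of N ` {f. f permutes {..<N}} = permutations_of_set {1..N}"
    by (intro card_subset_eq) auto
  then show ?thesis using inj by (simp add: bij_betw_def)
qed

lemma pmp_gen_poly_permutes:
  "pmp_gen_poly \<tau> N = (\<Sum>f | f permutes {..<N}. monom 1 (pmp \<tau> (word_of N f)))"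
  unfolding pmp_gen_poly_def by (rule sum.reindex_bij_betw[OF bij_betw_word_of, symmetric])

text \<open>The first two positions are split off so that the leading letters can be treated
  separately; the shift by \<open>Suc\<close> disappears under order isomorphism.\<close>

lemma has_match_at_word_of:
  assumes f: "f permutes {..<N}" and p: "a # b # p \<in> permutations_of_set {1..length (a # b # p)}"
  shows "has_match_at (a # b # p, u) (word_of N f) l \<longleftrightarrow>
    (\<exists>i0 i1 js. (i0 # i1 # js) ! u = l \<and> i0 < i1 \<and> i1 < N \<and> (\<forall>j\<in>set js. i1 < j) \<and>
       sorted_wrt (<) js \<and> set js \<subseteq> {..<N} \<and> order_iso (f i0 # f i1 # map f js) (a # b # p))"
proof -
  have red: "red (map (\<lambda>i. word_of N f ! i) ks) = a # b # p \<longleftrightarrow> order_iso (map f ks) (a # b # p)"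
    if ks: "sorted_wrt (<) ks" "set ks \<subseteq> {..<N}" for ks
  proof -
    have eq: "map (\<lambda>i. word_of N f ! i) ks = map Suc (map f ks)"
      using ks by (auto simp: word_of_def)
    have "distinct ks" using ks strict_sorted_iff by blast
    then have "distinct (map Suc (map f ks))"
      using permutes_inj[OF f] by (auto simp: distinct_map intro!: inj_onI dest: injD)
    then show ?thesis
      unfolding eq by (simp only: red_eq_iff_order_iso[OF _ p] order_iso_map_Suc)
  qed
  have "has_match_at (a # b # p, u) (word_of N f) l \<longleftrightarrow>
    (\<exists>ks. sorted_wrt (<) ks \<and> set ks \<subseteq> {..<N} \<and> ks ! u = l \<and> order_iso (map f ks) (a # b # p))"
    unfolding has_match_at_def underlying_def upos_def fst_conv snd_conv
    using red by (auto simp: word_of_def order_iso_def)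
  also have "\<dots> \<longleftrightarrow> (\<exists>i0 i1 js. (i0 # i1 # js) ! u = l \<and> i0 < i1 \<and> i1 < N \<and> (\<forall>j\<in>set js. i1 < j) \<and>
       sorted_wrt (<) js \<and> set js \<subseteq> {..<N} \<and> order_iso (f i0 # f i1 # map f js) (a # b # p))"
    (is "?L \<longleftrightarrow> ?R")
  proof
    assume ?L
    then obtain ks where ks: "sorted_wrt (<) ks" "set ks \<subseteq> {..<N}" "ks ! u = l"
      "order_iso (map f ks) (a # b # p)" by blast
    from ks(4) obtain i0 i1 js where "ks = i0 # i1 # js"
      unfolding order_iso_def by (metis length_Suc_conv length_map length_Cons)
    then show ?R using ks by auto
  next
    assume ?R
    then obtain i0 i1 js where "(i0 # i1 # js) ! u = l" "i0 < i1" "i1 < N" "\<forall>j\<in>set js. i1 < j"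
       "sorted_wrt (<) js" "set js \<subseteq> {..<N}" "order_iso (f i0 # f i1 # map f js) (a # b # p)"
      by blast
    then show ?L by (intro exI[of _ "i0 # i1 # js"]) auto
  qed
  finally show ?thesis .
qed

lemma match_12_iff_pasc:
  assumes f: "f permutes {..<N}" and p: "\<forall>z\<in>set p. 2 < z"
    "1 # 2 # p \<in> permutations_of_set {1..length (1 # 2 # p)}" and l: "l < N"
  shows "has_match_at (1 # 2 # p, 1) (word_of N f) l \<longleftrightarrow> pasc (occurrence p) N f l"
  unfolding has_match_at_word_of[OF f p(2)] order_iso_12[OF p(1)] asc_end_def dominated_occurrence
  using l by auto

text \<open>Here \<open>l\<close> is the second position \<open>i1\<close>, and the rest of the
  match dominates the cell \<open>(i1, f i0)\<close>.\<close>

lemma match_21_second_iff_pdesc: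
  assumes f: "f permutes {..<N}" and p: "\<forall>z\<in>set p. 2 < z"
    "2 # 1 # p \<in> permutations_of_set {1..length (2 # 1 # p)}" and l: "l < N"
  shows "has_match_at (2 # 1 # p, 1) (word_of N f) l \<longleftrightarrow> pdesc (occurrence p) N f l"
  unfolding has_match_at_word_of[OF f p(2)] order_iso_21[OF p(1)] desc_end_def dominated_occurrence
  using l by (auto; blast)

lemma match_21_first_iff:
  assumes f: "f permutes {..<N}" and p: "\<forall>z\<in>set p. 2 < z"
    "2 # 1 # p \<in> permutations_of_set {1..length (2 # 1 # p)}" and l: "l < N"
  shows "has_match_at (2 # 1 # p, 0) (word_of N f) l \<longleftrightarrow>
    (\<exists>i>l. f i < f l \<and> dominated (occurrence p) (points N f) i (f l))"
proof -
  \<comment> \<open>A match needs its second position below \<open>N\<close>, while the right-hand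
    side leaves \<open>i\<close> unbounded; \<open>f i < f l < N\<close> supplies the bound.\<close>
  have "i < N" if "f i < f l" for i
  proof -
    have "f l < N" using permutes_in_image[OF f, of l] l by simp
    then show ?thesis using permutes_in_image[OF f, of i] that by simp
  qed
  then show ?thesis
    unfolding has_match_at_word_of[OF f p(2)] order_iso_21[OF p(1)] dominated_occurrence
    by (auto; blast)
qed

theorem theorem3:
  fixes n :: nat and p :: "nat list"
  assumes "n \<ge> 4"
    and "p \<in> permutations_of_set {3..n}"
  shows "pmp_Wilf_equivalent (1 # 2 # p, 1) (2 # 1 # p, 0) \<and>
         pmp_Wilf_equivalent (1 # 2 # p, 1) (2 # 1 # p, 1) \<and>
         pmp_Wilf_equivalent (2 # 1 # p, 0) (2 # 1 # p, 1)"
proof -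
  have set_p: "set p = {3..n}" and dist: "distinct p"
    using assms(2) by (auto simp: permutations_of_set_def)
  then have "length p = card {3..n}" using distinct_card by metis
  then have len: "length p = n - 2" by simp
  have gt: "\<forall>z\<in>set p. 2 < z" using set_p by simp
  \<comment> \<open>The length \<open>n - 2\<close> of \<open>p\<close> turns the required range
    into \<open>{1..n}\<close>, which is 1 and 2 together with the letters of
    \<open>p\<close>.\<close>
  have perm12: "1 # 2 # p \<in> permutations_of_set {1..length (1 # 2 # p)}"
    and perm21: "2 # 1 # p \<in> permutations_of_set {1..length (2 # 1 # p)}"
    using set_p dist len assms(1) by (auto simp: permutations_of_set_def)
  have marked: "positional_marked_pattern (1 # 2 # p, 1)"
    "positional_marked_pattern (2 # 1 # p, 0)" "positional_marked_pattern (2 # 1 # p, 1)"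
    using perm12 perm21 by (auto simp: positional_marked_pattern_def underlying_def upos_def)
  have len_word: "length (word_of N f) = N" for N f by (simp add: word_of_def)
  have "pmp_gen_poly (1 # 2 # p, 1) N =
      (\<Sum>f | f permutes {..<N}. monom 1 (card {l. l < N \<and> pasc (occurrence p) N f l}))" for N
    unfolding pmp_gen_poly_permutes pmp_def len_word
    by (intro sum.cong refl arg_cong[of _ _ "\<lambda>S. monom 1 (card S)"] Collect_cong conj_cong)
       (simp only: match_12_iff_pasc[OF _ gt perm12] mem_Collect_eq)
  moreover have "pmp_gen_poly (2 # 1 # p, 1) N =
      (\<Sum>f | f permutes {..<N}. monom 1 (card {l. l < N \<and> pdesc (occurrence p) N f l}))" for N
    unfolding pmp_gen_poly_permutes pmp_def len_word
    by (intro sum.cong refl arg_cong[of _ _ "\<lambda>S. monom 1 (card S)"] Collect_cong conj_cong)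
       (simp only: match_21_second_iff_pdesc[OF _ gt perm21] mem_Collect_eq)
  moreover have "pmp_gen_poly (2 # 1 # p, 0) N =
      (\<Sum>f | f permutes {..<N}. monom 1
        (card {l. l < N \<and> (\<exists>i>l. f i < f l \<and> dominated (occurrence p) (points N f) i (f l))}))" for N
    unfolding pmp_gen_poly_permutes pmp_def len_word
    by (intro sum.cong refl arg_cong[of _ _ "\<lambda>S. monom 1 (card S)"] Collect_cong conj_cong)
       (simp only: match_21_first_iff[OF _ gt perm21] mem_Collect_eq)
  ultimately show ?thesis
    using marked pasc_pdesc_equidistributed[of _ "occurrence p"]
      pasc_transposed_equidistributed[of _ "occurrence p"]
    unfolding pmp_Wilf_equivalent_def by simp
qed

end
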